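(* (Dominated Convergence Theorem.) Let $X$ be a Banach space over $\mathbb{C}$, $(\Omega,\Sigma)$ a measurable space, and $\mu=\{\mu_\Lambda \mid \Lambda\in X^*\}$ a vector projection family. If $(f_n)_{n\in\mathbb{N}}$ is a sequence in $L^1(\mu)$ such that $f_n\to f$ pointwise and there exists $g\in L^1(\mu)$ such that $|f_n|\leq g$ for each $n\in\mathbb{N}$, then $f\in L^1(\mu)$ and $$\int f_n\,d\mu\to\int f\,d\mu$$ in the weak-$*$ topology of $X^{**}$.
   Context: $\mathcal{M}(\Omega)$ is the space of complex measures on $(\Omega,\Sigma)$. A net $(\mu_i)$ in $\mathcal{M}(\Omega)$ converges setwise to $\mu$ if $\mu_i(E)\to\mu(E)$ for every $E\in\Sigma$. A vector projection family is a collection $\{\mu_\Lambda \mid \Lambda\in X^*\}\subset\mathcal{M}(\Omega)$ such that (1) $\Lambda\mapsto\mu_\Lambda$ is linear from $X^*$ to $\mathcal{M}(\Omega)$; (2) if a net $(\Lambda_i)$ in $X^*$ converges in norm to $\Lambda$, then $\mu_{\Lambda_i}\to\mu_\Lambda$ setwise. A measurable $f\colon\Omega\to\mathbb{C}$ belongs to $L^1(\mu)$ if $f\in L^1(\mu_\Lambda)$ (that is, $\int|f|\,d|\mu_\Lambda|<\infty$) for each $\Lambda\in X^*$. For $f\in L^1(\mu)$, the integral $\int f\,d\mu$ is the map $X^*\to\mathbb{C}$, $\Lambda\mapsto\int_\Omega f\,d\mu_\Lambda$; it is an element of $X^{**}$. The weak-$*$ topology of $X^{**}$ is the topology of pointwise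 convergence on $X^*$. *)

theory Defs
  imports "HOL-Analysis.Analysis"
begin

subsection \<open>Complex normed spaces, dual and weak-star topology\<close>

class scaleC =
  fixes scaleC :: "complex \<Rightarrow> 'a \<Rightarrow> 'a" (infixr \<open>*\<^sub>C\<close> 75)

class complex_normed_vector = real_normed_vector + scaleC +
  assumes scaleC_add_right: "a *\<^sub>C (x + y) = a *\<^sub>C x + a *\<^sub>C y"
    and scaleC_add_left: "(a + b) *\<^sub>C x = a *\<^sub>C x + b *\<^sub>C x"
    and scaleC_scaleC: "a *\<^sub>C b *\<^sub>C x = (a * b) *\<^sub>C x"
    and scaleC_of_real: "complex_of_real r *\<^sub>C x = r *\<^sub>R x"
    and norm_scaleC: "norm (a *\<^sub>C x) = cmod a * norm x"

class complex_banach = complex_normed_vector + complete_space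

instantiation complex :: complex_banach
begin

definition scaleC_complex :: "complex \<Rightarrow> complex \<Rightarrow> complex"
  where "scaleC_complex a x = a * x"

instance
  by standard (simp_all add: scaleC_complex_def algebra_simps norm_mult scaleR_conv_of_real)

end

definition bounded_clinear :: "('a::complex_normed_vector \<Rightarrow> 'b::complex_normed_vector) \<Rightarrow> bool"
  where "bounded_clinear f \<longleftrightarrow> bounded_linear f \<and> (\<forall>c x. f (c *\<^sub>C x) = c *\<^sub>C f x)"

typedef (overloaded) 'a cdual = "{f :: 'a::complex_normed_vector \<Rightarrow> complex. bounded_clinear f}"
  morphisms cdual_apply Cdual
proof
  show "(\<lambda>_. 0) \<in> {f :: 'a \<Rightarrow> complex. bounded_clinear f}"
    by (simp add: bounded_clinear_def scaleC_complex_def)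
qed

setup_lifting type_definition_cdual

lemma bounded_clinear_cdual_apply: "bounded_clinear (cdual_apply F)"
  using cdual_apply by blast

lemma bounded_linear_cdual_apply: "bounded_linear (cdual_apply F)"
  using bounded_clinear_cdual_apply bounded_clinear_def by blast

instantiation cdual :: (complex_normed_vector) complex_normed_vector
begin

lift_definition norm_cdual :: "'a cdual \<Rightarrow> real" is onorm .

lift_definition zero_cdual :: "'a cdual" is "\<lambda>x. 0"
  by (simp add: bounded_clinear_def scaleC_complex_def)

lift_definition plus_cdual :: "'a cdual \<Rightarrow> 'a cdual \<Rightarrow> 'a cdual" is "\<lambda>f g x. f x + g x"
  by (auto simp: bounded_clinear_def scaleC_add_right intro: bounded_linear_add)

lift_definition minus_cdual :: "'a cdual \<Rightarrow> 'a cdual \<Rightarrow> 'a cdual" is "\<lambda>f g x. f x - g x"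
  by (auto simp: bounded_clinear_def scaleC_complex_def algebra_simps intro: bounded_linear_sub)

lift_definition uminus_cdual :: "'a cdual \<Rightarrow> 'a cdual" is "\<lambda>f x. - f x"
  by (auto simp: bounded_clinear_def scaleC_complex_def intro: bounded_linear_minus)

lift_definition scaleC_cdual :: "complex \<Rightarrow> 'a cdual \<Rightarrow> 'a cdual" is "\<lambda>c f x. c *\<^sub>C f x"
  by (auto simp: bounded_clinear_def scaleC_complex_def intro: bounded_linear_const_mult)

lift_definition scaleR_cdual :: "real \<Rightarrow> 'a cdual \<Rightarrow> 'a cdual" is "\<lambda>r f x. r *\<^sub>R f x"
  by (auto simp: bounded_clinear_def scaleC_complex_def intro: bounded_linear_const_scaleR)

definition dist_cdual :: "'a cdual \<Rightarrow> 'a cdual \<Rightarrow> real"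
  where "dist_cdual F G = norm (F - G)"

definition sgn_cdual :: "'a cdual \<Rightarrow> 'a cdual"
  where "sgn_cdual F = inverse (norm F) *\<^sub>R F"

definition uniformity_cdual :: "('a cdual \<times> 'a cdual) filter"
  where "uniformity_cdual = (INF e\<in>{0<..}. principal {(F, G). dist F G < e})"

definition open_cdual :: "'a cdual set \<Rightarrow> bool"
  where "open_cdual U = (\<forall>F\<in>U. \<forall>\<^sub>F (F', G) in uniformity. F' = F \<longrightarrow> G \<in> U)"

instance
proof
  fix F G H :: "'a cdual" and a b :: complex and r s :: real and U :: "'a cdual set"
  show "F + G + H = F + (G + H)" "F + G = G + F" "0 + F = F" "- F + F = 0" "F - G = F + - G"
    by (transfer, simp add: algebra_simps)+
  show "r *\<^sub>R (F + G) = r *\<^sub>R F + r *\<^sub>R G" "(r + s) *\<^sub>R F = r *\<^sub>R F + s *\<^sub>R F"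
    "r *\<^sub>R s *\<^sub>R F = (r * s) *\<^sub>R F" "1 *\<^sub>R F = F"
    by (transfer, simp add: algebra_simps)+
  show "dist F G = norm (F - G)" "sgn F = inverse (norm F) *\<^sub>R F"
    by (simp_all add: dist_cdual_def sgn_cdual_def)
  show "uniformity = (INF e\<in>{0<..}. principal {(F::'a cdual, G). dist F G < e})"
    by (simp add: uniformity_cdual_def)
  show "open U = (\<forall>F\<in>U. \<forall>\<^sub>F (F', G) in uniformity. F' = F \<longrightarrow> G \<in> U)"
    by (simp add: open_cdual_def)
  show "norm F = 0 \<longleftrightarrow> F = 0"
    by transfer (auto simp: bounded_clinear_def onorm_eq_0)
  show "norm (F + G) \<le> norm F + norm G"
    by transfer (auto simp: bounded_clinear_def intro: onorm_triangle)
  show "norm (r *\<^sub>R F) = \<bar>r\<bar> * norm F"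
    by transfer (auto simp: bounded_clinear_def onorm_scaleR)
  show "a *\<^sub>C (F + G) = a *\<^sub>C F + a *\<^sub>C G" "(a + b) *\<^sub>C F = a *\<^sub>C F + b *\<^sub>C F"
    "a *\<^sub>C b *\<^sub>C F = (a * b) *\<^sub>C F" "complex_of_real r *\<^sub>C F = r *\<^sub>R F"
    by (transfer, simp add: scaleC_complex_def algebra_simps scaleR_conv_of_real)+
  show "norm (a *\<^sub>C F) = cmod a * norm F"
  proof -
    have "onorm (\<lambda>x. a *\<^sub>C cdual_apply F x) = onorm (\<lambda>x. cmod a *\<^sub>R cdual_apply F x)"
      by (simp add: onorm_def scaleC_complex_def norm_mult)
    then show ?thesis
      by (simp add: norm_cdual.rep_eq scaleC_cdual.rep_eq onorm_scaleR bounded_linear_cdual_apply)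
  qed
qed

end

text \<open>The dual of \<open>'b\<close> as a set of functionals, with the topology of pointwise convergence;
  for \<open>'b = 'a cdual\<close> this is the bidual of \<open>'a\<close> with its weak-star topology.\<close>

definition weak_star_topology :: "('b::complex_normed_vector \<Rightarrow> complex) topology"
  where "weak_star_topology =
    subtopology (product_topology (\<lambda>_. euclidean) UNIV) {\<Phi>. bounded_clinear \<Phi>}"


subsection \<open>Complex measures\<close>

text \<open>Below, a value \<open>M\<close> of type \<open>'w measure\<close> only serves as the measurable space
  \<open>(space M, sets M)\<close>; its own measure is never used. Set functions are only relevant on
  \<open>sets M\<close>.\<close>

definition complex_measure :: "'w measure \<Rightarrow> ('w set \<Rightarrow> complex) \<Rightarrow> bool"
  where "complex_measure M \<nu> \<longleftrightarrow>
    (\<forall>A :: nat \<Rightarrow> 'w set. range A \<subseteq> sets M \<longrightarrow> disjoint_family A \<longrightarrow>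
      (\<lambda>n. \<nu> (A n)) sums \<nu> (\<Union>n. A n))"

text \<open>The total variation \<open>|\<nu>|\<close>: supremum of \<open>\<Sum>n. |\<nu> (A n)|\<close> over countable measurable
  partitions. For a complex measure this set function is countably additive, so that
  \<open>measure_of\<close> does not fall back to the zero measure; likewise for \<open>positive_variation\<close>.\<close>

definition total_variation :: "'w measure \<Rightarrow> ('w set \<Rightarrow> complex) \<Rightarrow> 'w measure"
  where "total_variation M \<nu> = measure_of (space M) (sets M)
    (\<lambda>E. SUP A \<in> {A :: nat \<Rightarrow> 'w set. range A \<subseteq> sets M \<and> disjoint_family A \<and> (\<Union>n. A n) = E}.
       \<Sum>n. ennreal (cmod (\<nu> (A n))))"

text \<open>The positive part \<open>\<rho>\<^sup>+\<close> of the Jordan decomposition of a finite signed measure \<open>\<rho>\<close>,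
  \<open>\<rho>\<^sup>+ E = sup {\<rho> F | F \<subseteq> E}\<close>; the negative part is \<open>(- \<rho>)\<^sup>+\<close>. The coercion \<open>ennreal\<close>
  truncates negative values to \<open>0 = \<rho> {}\<close>, which does not affect the supremum.\<close>

definition positive_variation :: "'w measure \<Rightarrow> ('w set \<Rightarrow> real) \<Rightarrow> 'w measure"
  where "positive_variation M \<rho> = measure_of (space M) (sets M)
    (\<lambda>E. SUP F \<in> {F \<in> sets M. F \<subseteq> E}. ennreal (\<rho> F))"

definition signed_integral :: "'w measure \<Rightarrow> ('w set \<Rightarrow> real) \<Rightarrow> ('w \<Rightarrow> complex) \<Rightarrow> complex"
  where "signed_integral M \<rho> f =
    integral\<^sup>L (positive_variation M \<rho>) f - integral\<^sup>L (positive_variation M (\<lambda>E. - \<rho> E)) f"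

definition complex_integral :: "'w measure \<Rightarrow> ('w set \<Rightarrow> complex) \<Rightarrow> ('w \<Rightarrow> complex) \<Rightarrow> complex"
  where "complex_integral M \<nu> f =
    signed_integral M (\<lambda>E. Re (\<nu> E)) f + \<i> * signed_integral M (\<lambda>E. Im (\<nu> E)) f"

definition setwise_tendsto ::
    "'w measure \<Rightarrow> ('i \<Rightarrow> 'w set \<Rightarrow> complex) \<Rightarrow> ('w set \<Rightarrow> complex) \<Rightarrow> 'i filter \<Rightarrow> bool"
  where "setwise_tendsto M \<nu> \<nu>\<^sub>0 F \<longleftrightarrow> (\<forall>E\<in>sets M. ((\<lambda>i. \<nu> i E) \<longlongrightarrow> \<nu>\<^sub>0 E) F)"


subsection \<open>Vector projection families\<close>

text \<open>Nets in the dual are rendered by filters on it: convergence of a net only depends on the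
  filter generated by its tails, and every proper filter arises from a net in this way.\<close>

definition vector_projection_family ::
    "'w measure \<Rightarrow> ('x::complex_normed_vector cdual \<Rightarrow> 'w set \<Rightarrow> complex) \<Rightarrow> bool"
  where "vector_projection_family M \<mu> \<longleftrightarrow>
    (\<forall>\<Lambda>. complex_measure M (\<mu> \<Lambda>)) \<and>
    (\<forall>\<Lambda> \<Lambda>'. \<forall>E\<in>sets M. \<mu> (\<Lambda> + \<Lambda>') E = \<mu> \<Lambda> E + \<mu> \<Lambda>' E) \<and>
    (\<forall>c \<Lambda>. \<forall>E\<in>sets M. \<mu> (c *\<^sub>C \<Lambda>) E = c * \<mu> \<Lambda> E) \<and>
    (\<forall>(F :: 'x cdual filter) \<Lambda>. ((\<lambda>\<Lambda>'. \<Lambda>') \<longlongrightarrow> \<Lambda>) F \<longrightarrow> setwise_tendsto M \<mu> (\<mu> \<Lambda>) F)"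

definition vector_L1 ::
    "'w measure \<Rightarrow> ('x::complex_normed_vector cdual \<Rightarrow> 'w set \<Rightarrow> complex) \<Rightarrow> ('w \<Rightarrow> complex) set"
  where "vector_L1 M \<mu> =
    {f \<in> borel_measurable M. \<forall>\<Lambda>. integrable (total_variation M (\<mu> \<Lambda>)) f}"

definition vector_integral ::
    "'w measure \<Rightarrow> ('x::complex_normed_vector cdual \<Rightarrow> 'w set \<Rightarrow> complex) \<Rightarrow> ('w \<Rightarrow> complex) \<Rightarrow>
      'x cdual \<Rightarrow> complex"
  where "vector_integral M \<mu> f = (\<lambda>\<Lambda>. complex_integral M (\<mu> \<Lambda>) f)"

end

(* For a single complex measure the integral is a combination of the integrals against the four
   Jordan variations of the real and imaginary parts. A Hahn decomposition shows that these are
   finite measures, and they are dominated by the total variation, so the scalar dominated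
   convergence theorem gives pointwise convergence on the dual. The remaining point is that the
   integral of h is a bounded linear functional on the dual: approximating h by simple functions s
   with norm at most 2|h| exhibits it as a pointwise limit of the functionals
   Lambda |-> sum_y y * mu_Lambda(s = y). These are linear and, by setwise continuity of the family,
   norm continuous, so the uniform boundedness principle on the (complete) dual applies. *)
theory Submission
  imports Defs
begin

subsection \<open>Countably additive set functions\<close>

locale sigma_additive =
  fixes M :: "'w measure" and \<nu> :: "'w set \<Rightarrow> 'b::real_normed_vector"
  assumes sums_UN: "range A \<subseteq> sets M \<Longrightarrow> disjoint_family A \<Longrightarrow>
    (\<lambda>n. \<nu> (A n)) sums \<nu> (\<Union>n::nat. A n)"
begin

text \<open>For the constant family of empty sets, additivity makes a constant series summable, so
  its term is \<open>0\<close>.\<close>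

lemma empty [simp]: "\<nu> {} = 0"
  using sums_UN[of "\<lambda>_. {}"] sums_summable[of "\<lambda>_::nat. \<nu> {}"]
  by (auto simp: disjoint_family_on_def summable_const_iff)

lemma Un_disjoint:
  assumes "A \<in> sets M" "B \<in> sets M" "A \<inter> B = {}"
  shows "\<nu> (A \<union> B) = \<nu> A + \<nu> B"
proof -
  have "(\<lambda>n. \<nu> (binaryset A B n)) sums \<nu> (\<Union>n. binaryset A B n)"
    using assms by (intro sums_UN) (auto simp: disjoint_family_on_def binaryset_def)
  then show ?thesis
    using binaryset_sums[of \<nu> A B] by (simp add: UN_binaryset_eq sums_unique2)
qed

lemma split_Int_Diff:
  assumes "A \<in> sets M" "B \<in> sets M"
  shows "\<nu> A = \<nu> (A \<inter> B) + \<nu> (A - B)"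
  using assms Un_disjoint[of "A \<inter> B" "A - B"] by (simp add: Int_Diff_Un Int_Diff_disjoint)

lemma split_subset:
  assumes "A \<in> sets M" "B \<in> sets M" "B \<subseteq> A"
  shows "\<nu> A = \<nu> B + \<nu> (A - B)"
  using split_Int_Diff[OF assms(1,2)] assms(3) by (simp add: Int_absorb1)

lemma bounded_linear_image:
  assumes "bounded_linear h"
  shows "sigma_additive M (\<lambda>E. h (\<nu> E))"
  by unfold_locales (simp add: bounded_linear.sums[OF assms] sums_UN)

end

lemma complex_measure_iff: "complex_measure M \<nu> \<longleftrightarrow> sigma_additive M \<nu>"
  by (auto simp: complex_measure_def sigma_additive_def)


subsection \<open>Hahn decomposition\<close>

locale signed_measure = sigma_additive M \<rho> for M :: "'w measure" and \<rho> :: "'w set \<Rightarrow> real"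
begin

definition positive_set :: "'w set \<Rightarrow> bool"
  where "positive_set A \<longleftrightarrow> A \<in> sets M \<and> (\<forall>B\<in>sets M. B \<subseteq> A \<longrightarrow> 0 \<le> \<rho> B)"

text \<open>The greedy choice: removing such sets \<open>B\<close> from \<open>D\<close> again and again leaves a positive set, since
  their values are summable and hence tend to \<open>0\<close>. The \<open>min 1\<close> spares a proof that \<open>\<rho>\<close> is bounded.\<close>

lemma exists_nearly_most_negative:
  assumes D: "D \<in> sets M"
  shows "\<exists>B\<in>sets M. B \<subseteq> D \<and> \<rho> B \<le> 0 \<and>
    (\<forall>C\<in>sets M. C \<subseteq> D \<longrightarrow> min 1 (- \<rho> C / 2) \<le> - \<rho> B)"
proof (cases "\<exists>B\<in>sets M. B \<subseteq> D \<and> \<rho> B \<le> -1")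
  case True
  then obtain B where "B \<in> sets M" "B \<subseteq> D" "\<rho> B \<le> -1" by blast
  then show ?thesis by (intro bexI[of _ B]) (auto simp: min_def)
next
  case False
  define S where "S = {- \<rho> C |C. C \<in> sets M \<and> C \<subseteq> D}"
  have bdd: "bdd_above S"
    using False by (intro bdd_aboveI[of _ 1]) (force simp: S_def)
  have "- \<rho> {} \<in> S" unfolding S_def by blast
  then have zero: "0 \<in> S" by simp
  have up: "- \<rho> C \<le> Sup S" if "C \<in> sets M" "C \<subseteq> D" for C
    using that bdd by (intro cSup_upper) (auto simp: S_def)
  show ?thesis
  proof (cases "Sup S > 0")
    case True
    \<comment> \<open>All values exceed \<open>-1\<close>, so the supremum is finite; being
      positive, half of it is beaten by some \<open>B\<close>.\<close>
    then have "Sup S / 2 < Sup S" by simp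
    then obtain x where x: "x \<in> S" "Sup S / 2 < x"
      using less_cSupD[of S] zero by blast
    then obtain B where B: "B \<in> sets M" "B \<subseteq> D" "Sup S / 2 < - \<rho> B"
      unfolding S_def by blast
    have "min 1 (- \<rho> C / 2) \<le> - \<rho> B" if "C \<in> sets M" "C \<subseteq> D" for C
      using up[OF that] B(3) by (simp add: min_le_iff_disj)
    then show ?thesis using B True by (intro bexI[of _ B]) auto
  next
    case False
    have "min 1 (- \<rho> C / 2) \<le> 0" if "C \<in> sets M" "C \<subseteq> D" for C
      using up[OF that] False by (simp add: min_le_iff_disj)
    then show ?thesis by (intro bexI[of _ "{}"]) auto
  qed
qed

text \<open>Picked sets are removed from \<open>D\<close> one after another. Their total value is at
  most \<open>0\<close>, so the remainder keeps at least the value of \<open>D\<close>.\<close>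

lemma exists_positive_subset:
  assumes D: "D \<in> sets M"
  shows "\<exists>A. positive_set A \<and> A \<subseteq> D \<and> \<rho> D \<le> \<rho> A"
proof -
  have "\<forall>E\<in>sets M. \<exists>B. B \<in> sets M \<and> B \<subseteq> E \<and> \<rho> B \<le> 0 \<and>
      (\<forall>C\<in>sets M. C \<subseteq> E \<longrightarrow> min 1 (- \<rho> C / 2) \<le> - \<rho> B)"
    using exists_nearly_most_negative by (simp add: Bex_def)
  from bchoice[OF this] obtain pick where "\<forall>E\<in>sets M. pick E \<in> sets M \<and> pick E \<subseteq> E \<and>
      \<rho> (pick E) \<le> 0 \<and> (\<forall>C\<in>sets M. C \<subseteq> E \<longrightarrow> min 1 (- \<rho> C / 2) \<le> - \<rho> (pick E))"
    by auto
  then have pick: "pick E \<in> sets M" "pick E \<subseteq> E" "\<rho> (pick E) \<le> 0"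
      "\<And>C. C \<in> sets M \<Longrightarrow> C \<subseteq> E \<Longrightarrow> min 1 (- \<rho> C / 2) \<le> - \<rho> (pick E)"
    if "E \<in> sets M" for E
    using that by auto
  define R where "R = rec_nat D (\<lambda>_ E. E - pick E)"
  have R_Suc: "R (Suc n) = R n - pick (R n)" and R_0: "R 0 = D" for n
    by (simp_all add: R_def)
  have R_sets: "R n \<in> sets M" for n
    by (induction n) (auto simp: R_0 R_Suc D pick(1))
  have R_anti: "R n \<subseteq> R m" if "m \<le> n" for m n
    using that by (induction rule: dec_induct) (auto simp: R_Suc)
  define b where "b n = pick (R n)" for n
  have b: "b n \<in> sets M" "b n \<subseteq> R n" "\<rho> (b n) \<le> 0" for n
    using pick(1-3)[OF R_sets[of n]] by (simp_all add: b_def)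
  have b_disj: "b m \<inter> b n = {}" if "m < n" for m n
    using R_anti[of "Suc m" n] that b(2)[of n] by (auto simp: R_Suc b_def)
  have "disjoint_family b"
    unfolding disjoint_family_on_def using b_disj by (metis Int_commute nat_neq_iff)
  then have sums: "(\<lambda>n. \<rho> (b n)) sums \<rho> (\<Union>n. b n)"
    using b by (intro sums_UN) auto
  define A where "A = D - (\<Union>n. b n)"
  have UN_D: "(\<Union>n. b n) \<subseteq> D"
    using b(2) R_anti[of 0] by (fastforce simp: R_0)
  have A_sets: "A \<in> sets M" using D b(1) by (auto simp: A_def)
  have "\<rho> (\<Union>n. b n) \<le> 0"
    using b(3) by (intro sums_le[OF _ sums sums_zero])
  moreover have "\<rho> D = \<rho> (\<Union>n. b n) + \<rho> A"
    unfolding A_def using D b(1) UN_D by (intro split_subset) auto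
  ultimately have le: "\<rho> D \<le> \<rho> A" by simp
  have A_R: "A \<subseteq> R n" for n
    by (induction n) (auto simp: A_def R_0 R_Suc b_def)
  have "0 \<le> \<rho> C" if C: "C \<in> sets M" "C \<subseteq> A" for C
  proof -
    \<comment> \<open>\<open>C\<close> lies in every \<open>R n\<close> and so competes with every
      pick; in the limit only \<open>0 \<le> \<rho> C\<close> is possible.\<close>
    have "min 1 (- \<rho> C / 2) \<le> - \<rho> (b n)" for n
      using pick(4)[OF R_sets[of n] C(1)] C(2) A_R[of n] by (auto simp: b_def)
    moreover have "(\<lambda>n. - \<rho> (b n)) \<longlonglongrightarrow> - 0"
      using sums by (intro tendsto_minus summable_LIMSEQ_zero) (auto simp: summable_def)
    ultimately have "min 1 (- \<rho> C / 2) \<le> 0"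
      by (intro LIMSEQ_le_const) auto
    then show ?thesis by (simp add: min_le_iff_disj)
  qed
  then show ?thesis
    using A_sets le by (intro exI[of _ A]) (auto simp: positive_set_def A_def)
qed

text \<open>A subset of the union is cut along the disjointed sequence, each piece lying in a single
  \<open>A n\<close>.\<close>

lemma positive_set_UN:
  assumes A: "\<And>n::nat. positive_set (A n)"
  shows "positive_set (\<Union>n. A n)"
proof -
  have Am: "A n \<in> sets M" for n using A by (simp add: positive_set_def)
  have dm: "range (disjointed A) \<subseteq> sets M"
    using Am by (intro sets.range_disjointed_sets) auto
  have "0 \<le> \<rho> B" if B: "B \<in> sets M" "B \<subseteq> (\<Union>n. A n)" for B
  proof -
    have "(\<lambda>n. \<rho> (B \<inter> disjointed A n)) sums \<rho> (\<Union>n. B \<inter> disjointed A n)"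
      using dm B disjoint_family_disjointed[of A]
      by (intro sums_UN) (auto simp: subset_eq elim: disjoint_family_on_bisimulation)
    moreover have "(\<Union>n. B \<inter> disjointed A n) = B"
      using B(2) UN_disjointed_eq[of A] by auto
    moreover have "0 \<le> \<rho> (B \<inter> disjointed A n)" for n
      using A[of n] disjointed_subset[of A n] dm B
      by (metis Int_lower2 positive_set_def range_subsetD sets.Int subset_trans)
    ultimately show ?thesis
      using sums_le[OF _ sums_zero, of "\<lambda>n. \<rho> (B \<inter> disjointed A n)"] by simp
  qed
  then show ?thesis using Am by (auto simp: positive_set_def)
qed

lemma positive_set_mono:
  assumes "positive_set A" "B \<in> sets M" "B \<subseteq> A"
  shows "\<rho> B \<le> \<rho> A"
  using assms split_subset[of A B] by (auto simp: positive_set_def)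

text \<open>Testing with all \<open>B \<inter> P\<close> and \<open>B - P\<close> says that
  \<open>P\<close> is positive and its complement negative.\<close>

definition hahn_set :: "'w set \<Rightarrow> bool"
  where "hahn_set P \<longleftrightarrow> P \<in> sets M \<and> (\<forall>B\<in>sets M. 0 \<le> \<rho> (B \<inter> P) \<and> \<rho> (B - P) \<le> 0)"

text \<open>\<open>P\<close> is a positive set of largest value. If some \<open>B - P\<close> had
  positive value, a positive subset of it could be added to \<open>P\<close>, raising the
  maximum.\<close>

theorem Hahn_decomposition: "\<exists>P. hahn_set P"
proof -
  have "positive_set {}" by (auto simp: positive_set_def)
  then have "Collect positive_set \<noteq> {}" by blast
  \<comment> \<open>In \<open>ereal\<close> the supremum exists before any bound on
    \<open>\<rho>\<close> is known; it turns out finite because \<open>\<rho> P\<close> bounds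
    it.\<close>
  from SUP_countable_SUP[OF this, of "\<lambda>A. ereal (\<rho> A)"]
  obtain x :: "nat \<Rightarrow> ereal" where x: "range x \<subseteq> (\<lambda>A. ereal (\<rho> A)) ` Collect positive_set"
    "(SUP A\<in>Collect positive_set. ereal (\<rho> A)) = (SUP n. x n)" by blast
  then have "\<exists>A. positive_set A \<and> x n = ereal (\<rho> A)" for n by auto
  then obtain A where A: "\<And>n. positive_set (A n)" "\<And>n. x n = ereal (\<rho> (A n))" by metis
  define P where "P = (\<Union>n. A n)"
  have P: "positive_set P" unfolding P_def by (intro positive_set_UN A)
  have "\<rho> (A n) \<le> \<rho> P" for n
    using A(1)[of n] by (intro positive_set_mono[OF P]) (auto simp: P_def positive_set_def)
  then have "(SUP n. x n) \<le> ereal (\<rho> P)" by (auto simp: A(2) intro: SUP_least)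
  with x(2) have max: "\<rho> B \<le> \<rho> P" if "positive_set B" for B
    using that SUP_upper[of B "Collect positive_set" "\<lambda>A. ereal (\<rho> A)"]
    by (metis dual_order.trans ereal_less_eq(3) mem_Collect_eq)
  have "\<rho> (B - P) \<le> 0" if B: "B \<in> sets M" for B
  proof -
    have Pm: "P \<in> sets M" using P by (simp add: positive_set_def)
    then obtain C where C: "positive_set C" "C \<subseteq> B - P" "\<rho> (B - P) \<le> \<rho> C"
      using exists_positive_subset[of "B - P"] B by auto
    have "positive_set (\<Union>n. if n = (0::nat) then P else C)"
      by (intro positive_set_UN) (simp add: P C)
    also have "(\<Union>n. if n = (0::nat) then P else C) = P \<union> C"
      by (auto split: if_splits)
    finally have "\<rho> (P \<union> C) \<le> \<rho> P" by (rule max)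
    moreover have "\<rho> (P \<union> C) = \<rho> P + \<rho> C"
      using C Pm by (intro Un_disjoint) (auto simp: positive_set_def)
    ultimately show ?thesis using C(3) by simp
  qed
  then show ?thesis using P by (auto simp: hahn_set_def positive_set_def intro!: exI[of _ P])
qed

text \<open>The supremum is attained at \<open>E \<inter> P\<close>: passing from \<open>F\<close>
  to \<open>F \<inter> P\<close> drops a nonpositive part, and enlarging to
  \<open>E \<inter> P\<close> adds a nonnegative one.\<close>

lemma emeasure_positive_variation:
  assumes P: "hahn_set P" and E: "E \<in> sets M"
  shows "emeasure (positive_variation M \<rho>) E = ennreal (\<rho> (E \<inter> P))"
proof -
  let ?v = "\<lambda>E. SUP F \<in> {F \<in> sets M. F \<subseteq> E}. ennreal (\<rho> F)"
  have Pm: "P \<in> sets M" and Ppos: "\<And>B. B \<in> sets M \<Longrightarrow> 0 \<le> \<rho> (B \<inter> P)"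
    and Pneg: "\<And>B. B \<in> sets M \<Longrightarrow> \<rho> (B - P) \<le> 0"
    using P by (auto simp: hahn_set_def)
  have v: "?v E = ennreal (\<rho> (E \<inter> P))" if E: "E \<in> sets M" for E
  proof (intro antisym SUP_least)
    fix F assume "F \<in> {F \<in> sets M. F \<subseteq> E}"
    then have F: "F \<in> sets M" "F \<subseteq> E" by auto
    have "\<rho> (E \<inter> P) = \<rho> (F \<inter> P) + \<rho> ((E - F) \<inter> P)"
      using split_subset[of "E \<inter> P" "F \<inter> P"] F E Pm
      by (simp add: Diff_Int_distrib2 le_infI1)
    then have "\<rho> F \<le> \<rho> (E \<inter> P)"
      using split_Int_Diff[OF F(1) Pm] Pneg[OF F(1)] Ppos[of "E - F"] E F by auto
    then show "ennreal (\<rho> F) \<le> ennreal (\<rho> (E \<inter> P))" by (rule ennreal_leI)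
  next
    show "ennreal (\<rho> (E \<inter> P)) \<le> ?v E"
      using E Pm by (intro SUP_upper) auto
  qed
  show ?thesis
  proof (subst v[OF E, symmetric], unfold positive_variation_def, rule emeasure_measure_of_sigma)
    show "positive (sets M) ?v"
      by (simp add: positive_def v)
    \<comment> \<open>By \<open>v\<close> this reduces to additivity of \<open>\<rho>\<close> on the
      sets \<open>A n \<inter> P\<close>.\<close>
    show "countably_additive (sets M) ?v"
    proof (rule countably_additiveI)
      fix A :: "nat \<Rightarrow> 'w set"
      assume A: "range A \<subseteq> sets M" "disjoint_family A" "(\<Union>i. A i) \<in> sets M"
      have "(\<lambda>n. \<rho> (A n \<inter> P)) sums \<rho> (\<Union>n. A n \<inter> P)"
        using A Pm by (intro sums_UN) (auto simp: disjoint_family_on_def)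
      then have "(\<Sum>n. ennreal (\<rho> (A n \<inter> P))) = ennreal (\<rho> (\<Union>n. A n \<inter> P))"
        using A by (intro suminf_ennreal_eq Ppos) auto
      then show "(\<Sum>n. ?v (A n)) = ?v (\<Union>n. A n)"
        using v[OF A(3)] v[of "A n" for n] A(1) by (simp add: range_subsetD)
    qed
  qed (auto simp: E sets.sigma_algebra_axioms)
qed

lemma sets_positive_variation [simp]: "sets (positive_variation M \<rho>) = sets M"
  by (simp add: positive_variation_def)

lemma finite_measure_positive_variation: "finite_measure (positive_variation M \<rho>)"
proof -
  obtain P where P: "hahn_set P" using Hahn_decomposition by blast
  have "space (positive_variation M \<rho>) = space M"
    by (rule sets_eq_imp_space_eq) simp
  then show ?thesis
    by (intro finite_measureI) (simp add: emeasure_positive_variation[OF P])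
qed

lemma signed_measure_uminus: "signed_measure M (\<lambda>E. - \<rho> E)"
  by (simp add: signed_measure_def bounded_linear_image bounded_linear_minus bounded_linear_ident)

text \<open>The Jordan decomposition: the complement of a Hahn set for \<open>\<rho>\<close> is one
  for its negative, so the two measures are \<open>\<rho> (E \<inter> P)\<close> and
  \<open>- \<rho> (E - P)\<close>.\<close>

lemma measure_positive_variation_diff:
  assumes E: "E \<in> sets M"
  shows "measure (positive_variation M \<rho>) E - measure (positive_variation M (\<lambda>E. - \<rho> E)) E = \<rho> E"
proof -
  interpret neg: signed_measure M "\<lambda>E. - \<rho> E" by (rule signed_measure_uminus)
  obtain P where P: "hahn_set P" using Hahn_decomposition by blast
  have Pm: "P \<in> sets M" using P by (simp add: hahn_set_def)
  have compl: "B \<inter> (space M - P) = B - P" "B - (space M - P) = B \<inter> P" if "B \<in> sets M" for B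
    using sets.sets_into_space[OF that] by auto
  have "neg.hahn_set (space M - P)"
    using P by (auto simp: neg.hahn_set_def hahn_set_def compl)
  note neg.emeasure_positive_variation[OF this E]
  then have "measure (positive_variation M (\<lambda>E. - \<rho> E)) E = - \<rho> (E - P)"
    using P E by (simp add: measure_def compl hahn_set_def)
  moreover have "measure (positive_variation M \<rho>) E = \<rho> (E \<inter> P)"
    using P E emeasure_positive_variation[OF P E] by (simp add: measure_def hahn_set_def)
  ultimately show ?thesis using split_Int_Diff[OF E Pm] by simp
qed

end

section \<open>Series in the extended nonnegative reals\<close>

lemma ennreal_norm_sums_le:
  fixes f :: "nat \<Rightarrow> 'b::real_normed_vector"
  assumes "f sums s"
  shows "ennreal (norm s) \<le> (\<Sum>n. ennreal (norm (f n)))"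
proof (rule LIMSEQ_le_const2)
  show "(\<lambda>n. ennreal (norm (\<Sum>i<n. f i))) \<longlonglongrightarrow> ennreal (norm s)"
    using assms by (intro tendsto_ennrealI tendsto_norm) (simp add: sums_def)
  have "ennreal (norm (\<Sum>i<n. f i)) \<le> (\<Sum>n. ennreal (norm (f n)))" for n
  proof -
    have "ennreal (norm (\<Sum>i<n. f i)) \<le> (\<Sum>i<n. ennreal (norm (f i)))"
      by (simp add: norm_sum ennreal_leI)
    also have "\<dots> \<le> (\<Sum>n. ennreal (norm (f n)))"
      by (intro sum_le_suminf) auto
    finally show ?thesis .
  qed
  then show "\<exists>N. \<forall>n\<ge>N. ennreal (norm (\<Sum>i<n. f i)) \<le> (\<Sum>n. ennreal (norm (f n)))"
    by blast
qed

text \<open>One of the sums is read as an integral against counting measure.\<close>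

lemma suminf_swap_ennreal:
  fixes f :: "nat \<Rightarrow> nat \<Rightarrow> ennreal"
  shows "(\<Sum>i. \<Sum>j. f i j) = (\<Sum>j. \<Sum>i. f i j)"
  using nn_integral_suminf[of "\<lambda>j i. f i j" "count_space UNIV"]
  by (simp add: nn_integral_count_space_nat)


subsection \<open>Total variation\<close>

definition countable_partitions :: "'w measure \<Rightarrow> 'w set \<Rightarrow> (nat \<Rightarrow> 'w set) set"
  where "countable_partitions M E =
    {A. range A \<subseteq> sets M \<and> disjoint_family A \<and> (\<Union>n. A n) = E}"

lemma countable_partitions_trivial:
  assumes "E \<in> sets M"
  shows "binaryset E {} \<in> countable_partitions M E"
proof -
  have "disjoint_family (binaryset E {})"
    by (simp add: disjoint_family_on_def binaryset_def)
  then show ?thesis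
    using assms by (simp add: countable_partitions_def range_binaryset_eq UN_binaryset_eq)
qed

lemma disjoint_family_Int_right: "disjoint_family A \<Longrightarrow> disjoint_family (\<lambda>n. A n \<inter> F)"
  unfolding disjoint_family_on_def by blast

lemma countable_partitions_restrict:
  assumes "A \<in> countable_partitions M E" "F \<in> sets M" "F \<subseteq> E"
  shows "(\<lambda>n. A n \<inter> F) \<in> countable_partitions M F"
proof -
  have "range A \<subseteq> sets M" "disjoint_family A" and E: "(\<Union>n. A n) = E"
    using assms(1) by (simp_all add: countable_partitions_def)
  moreover have "(\<Union>n. A n \<inter> F) = F" using E assms(3) by blast
  moreover have "range (\<lambda>n. A n \<inter> F) \<subseteq> sets M"
    using calculation(1) assms(2) by (simp add: image_subset_iff sets.Int)
  ultimately show ?thesis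
    by (simp add: countable_partitions_def disjoint_family_Int_right)
qed

text \<open>\<open>prod_decode\<close> lists the doubly indexed pieces as a single sequence.\<close>

lemma countable_partitions_combine:
  assumes E: "disjoint_family E" and P: "\<And>i. P i \<in> countable_partitions M (E i)"
  shows "(\<lambda>n. case prod_decode n of (i, j) \<Rightarrow> P i j) \<in> countable_partitions M (\<Union>i. E i)"
proof -
  have P': "P i j \<in> sets M" "disjoint_family (P i)" "(\<Union>j. P i j) = E i" for i j
    using P[of i] by (auto simp: countable_partitions_def)
  have disj: "P i j \<inter> P i' j' = {}" if "(i, j) \<noteq> (i', j')" for i j i' j'
  proof (cases "i = i'")
    case True
    then show ?thesis using that disjoint_family_onD[OF P'(2)[of i], of j j'] by simp
  next
    case False
    then have "E i \<inter> E i' = {}" using disjoint_family_onD[OF E] by simp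
    then show ?thesis using P'(3)[of i] P'(3)[of i'] by blast
  qed
  have "disjoint_family (\<lambda>n. case prod_decode n of (i, j) \<Rightarrow> P i j)"
    unfolding disjoint_family_on_def
  proof (intro ballI impI)
    fix m n :: nat assume "m \<noteq> n"
    then have "prod_decode m \<noteq> prod_decode n" by (simp add: prod_decode_eq)
    then show "(case prod_decode m of (i, j) \<Rightarrow> P i j) \<inter> (case prod_decode n of (i, j) \<Rightarrow> P i j) = {}"
      using disj by (cases "prod_decode m"; cases "prod_decode n") (simp only: prod.case)
  qed
  moreover have "(\<Union>n. case prod_decode n of (i, j) \<Rightarrow> P i j) = (\<Union>i. \<Union>j. P i j)"
  proof -
    have "(\<Union>n. case prod_decode n of (i, j) \<Rightarrow> P i j) = (\<Union>x\<in>range prod_decode. case x of (i, j) \<Rightarrow> P i j)"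
      by auto
    also have "\<dots> = (\<Union>i. \<Union>j. P i j)" by (auto simp: surj_prod_decode)
    finally show ?thesis .
  qed
  ultimately show ?thesis
    using P' by (auto simp: countable_partitions_def split: prod.split)
qed

text \<open>The set function inside \<open>total_variation\<close>, kept apart until its countable
  additivity is known.\<close>

definition variation :: "'w measure \<Rightarrow> ('w set \<Rightarrow> complex) \<Rightarrow> 'w set \<Rightarrow> ennreal"
  where "variation M \<nu> E = (SUP A \<in> countable_partitions M E. \<Sum>n. ennreal (cmod (\<nu> (A n))))"

locale complex_measure_space = sigma_additive M \<nu> for M :: "'w measure" and \<nu> :: "'w set \<Rightarrow> complex"
begin

lemma norm_le_variation:
  assumes "E \<in> sets M"
  shows "ennreal (cmod (\<nu> E)) \<le> variation M \<nu> E"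
proof -
  have "(\<Sum>n. ennreal (cmod (\<nu> (binaryset E {} n)))) = ennreal (cmod (\<nu> E))"
    by (subst suminf_binaryset_eq) auto
  then show ?thesis
    using SUP_upper[OF countable_partitions_trivial[OF assms], of "\<lambda>A. \<Sum>n. ennreal (cmod (\<nu> (A n)))"]
    by (simp add: variation_def)
qed

text \<open>Each block \<open>A n\<close> is cut along the sets \<open>E i\<close> and estimated by
  the triangle inequality; once the sums are swapped, the pieces \<open>A n \<inter> E i\<close>
  partition \<open>E i\<close>.\<close>

lemma variation_UN_le:
  assumes E: "range E \<subseteq> sets M" "disjoint_family E"
  shows "variation M \<nu> (\<Union>i. E i) \<le> (\<Sum>i. variation M \<nu> (E i))"
proof (subst variation_def, intro SUP_least)
  fix A assume A: "A \<in> countable_partitions M (\<Union>i. E i)"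
  then have A': "\<And>n. A n \<in> sets M" "(\<Union>n. A n) = (\<Union>i. E i)"
    by (auto simp: countable_partitions_def)
  have "ennreal (cmod (\<nu> (A n))) \<le> (\<Sum>i. ennreal (cmod (\<nu> (A n \<inter> E i))))" for n
  proof (rule ennreal_norm_sums_le)
    have "(\<lambda>i. \<nu> (A n \<inter> E i)) sums \<nu> (\<Union>i. A n \<inter> E i)"
      using E A'(1) by (intro sums_UN) (auto elim: disjoint_family_on_bisimulation)
    moreover have "(\<Union>i. A n \<inter> E i) = A n" using A'(2) by blast
    ultimately show "(\<lambda>i. \<nu> (A n \<inter> E i)) sums \<nu> (A n)" by simp
  qed
  then have "(\<Sum>n. ennreal (cmod (\<nu> (A n)))) \<le> (\<Sum>n. \<Sum>i. ennreal (cmod (\<nu> (A n \<inter> E i))))"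
    by (intro suminf_le) auto
  also have "\<dots> = (\<Sum>i. \<Sum>n. ennreal (cmod (\<nu> (A n \<inter> E i))))"
    by (rule suminf_swap_ennreal)
  also have "\<dots> \<le> (\<Sum>i. variation M \<nu> (E i))"
    unfolding variation_def using E
    by (intro suminf_le SUP_upper countable_partitions_restrict[OF A]) auto
  finally show "(\<Sum>n. ennreal (cmod (\<nu> (A n)))) \<le> (\<Sum>i. variation M \<nu> (E i))" .
qed

text \<open>Partitions chosen independently on each \<open>E i\<close> combine to one of the union.
  It remains to exchange the sum over \<open>i\<close> with the supremum over such choices.\<close>

lemma variation_UN_ge:
  assumes E: "range E \<subseteq> sets M" "disjoint_family E"
  shows "(\<Sum>i. variation M \<nu> (E i)) \<le> variation M \<nu> (\<Union>i. E i)"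
proof -
  define \<P> where "\<P> = {P. \<forall>i. P i \<in> countable_partitions M (E i)}"
  define S where "S A = (\<Sum>j. ennreal (cmod (\<nu> (A j))))" for A :: "nat \<Rightarrow> 'w set"
  have triv: "(\<lambda>i. binaryset (E i) {}) \<in> \<P>"
    using E(1) by (auto simp: \<P>_def intro: countable_partitions_trivial)
  have "variation M \<nu> (E i) \<le> (SUP P\<in>\<P>. S (P i))" for i
    unfolding variation_def
  proof (intro SUP_least)
    fix A assume "A \<in> countable_partitions M (E i)"
    \<comment> \<open>A partition of one \<open>E i\<close> is completed by trivial partitions at
      the other indices.\<close>
    then have "(\<lambda>i. binaryset (E i) {})(i := A) \<in> \<P>" using triv by (simp add: \<P>_def)
    from SUP_upper[OF this, of "\<lambda>P. S (P i)"]
    show "(\<Sum>n. ennreal (cmod (\<nu> (A n)))) \<le> (SUP P\<in>\<P>. S (P i))" by (simp add: S_def)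
  qed
  then have "(\<Sum>i. variation M \<nu> (E i)) \<le> (\<Sum>i. SUP P\<in>\<P>. S (P i))"
    by (intro suminf_le) auto
  also have "\<dots> = (SUP P\<in>\<P>. \<Sum>i. S (P i))"
  proof (rule ennreal_suminf_SUP_eq_directed)
    fix P Q and N :: "nat set" assume PQ: "P \<in> \<P>" "Q \<in> \<P>"
    \<comment> \<open>Directedness: at each index the partition with the larger sum is
      taken.\<close>
    show "\<exists>R\<in>\<P>. \<forall>n\<in>N. S (P n) \<le> S (R n) \<and> S (Q n) \<le> S (R n)"
      using PQ by (intro bexI[of _ "\<lambda>n. if S (P n) \<le> S (Q n) then Q n else P n"])
        (auto simp: \<P>_def)
  qed
  also have "\<dots> \<le> variation M \<nu> (\<Union>i. E i)"
  proof (intro SUP_least)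
    fix P assume "P \<in> \<P>"
    then have "(\<lambda>n. case prod_decode n of (i, j) \<Rightarrow> P i j) \<in> countable_partitions M (\<Union>i. E i)"
      by (intro countable_partitions_combine E) (simp add: \<P>_def)
    from SUP_upper[OF this, of "\<lambda>A. \<Sum>n. ennreal (cmod (\<nu> (A n)))"]
    have "(\<Sum>n. ennreal (cmod (\<nu> (case prod_decode n of (i, j) \<Rightarrow> P i j)))) \<le> variation M \<nu> (\<Union>i. E i)"
      by (simp add: variation_def)
    moreover have "(\<Sum>n. (\<lambda>(i, j). ennreal (cmod (\<nu> (P i j)))) (prod_decode n)) = (\<Sum>i. S (P i))"
      by (rule suminf_ennreal_2dimen) (simp add: S_def)
    ultimately show "(\<Sum>i. S (P i)) \<le> variation M \<nu> (\<Union>i. E i)"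
      by (simp add: case_prod_unfold)
  qed
  finally show ?thesis .
qed

lemma emeasure_total_variation:
  assumes "E \<in> sets M"
  shows "emeasure (total_variation M \<nu>) E = variation M \<nu> E"
proof -
  have "variation M \<nu> {} \<le> 0"
    unfolding variation_def by (intro SUP_least) (auto simp: countable_partitions_def)
  then have "positive (sets M) (variation M \<nu>)" by (simp add: positive_def)
  moreover have "countably_additive (sets M) (variation M \<nu>)"
    by (intro countably_additiveI antisym variation_UN_le variation_UN_ge)
  ultimately show ?thesis
    unfolding total_variation_def variation_def[abs_def] countable_partitions_def
    using assms by (intro emeasure_measure_of_sigma) (auto simp: sets.sigma_algebra_axioms)
qed

end

section \<open>Comparison of the Jordan variations with the total variation\<close>

lemma sets_total_variation [simp]: "sets (total_variation M \<nu>) = sets M"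
  by (simp add: total_variation_def)

text \<open>The positive variation of \<open>E\<close> is the single value
  \<open>\<rho> (E \<inter> P)\<close>, hence at most
  \<open>cmod (\<nu> (E \<inter> P))\<close>.\<close>

lemma (in signed_measure) positive_variation_le_total_variation:
  assumes \<nu>: "complex_measure M \<nu>" and le: "\<And>E. E \<in> sets M \<Longrightarrow> \<bar>\<rho> E\<bar> \<le> cmod (\<nu> E)"
  shows "positive_variation M \<rho> \<le> total_variation M \<nu>"
proof -
  interpret complex_measure_space M \<nu>
    using \<nu> by (simp add: complex_measure_iff complex_measure_space_def)
  obtain P where P: "hahn_set P" using Hahn_decomposition by blast
  have Pm: "P \<in> sets M" using P by (simp add: hahn_set_def)
  have "emeasure (positive_variation M \<rho>) E \<le> emeasure (total_variation M \<nu>) E" if E: "E \<in> sets M" for E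
  proof -
    have "ennreal (\<rho> (E \<inter> P)) \<le> ennreal (cmod (\<nu> (E \<inter> P)))"
      using le[of "E \<inter> P"] E Pm by (intro ennreal_leI) auto
    also have "\<dots> \<le> emeasure (total_variation M \<nu>) (E \<inter> P)"
      using E Pm norm_le_variation[of "E \<inter> P"] by (simp add: emeasure_total_variation)
    also have "\<dots> \<le> emeasure (total_variation M \<nu>) E"
      using E by (intro emeasure_mono) auto
    finally show ?thesis by (simp add: emeasure_positive_variation[OF P E])
  qed
  \<comment> \<open>The order on measures compares \<open>emeasure\<close> on all sets; off
    \<open>sets M\<close> both sides are \<open>0\<close>.\<close>
  moreover have "emeasure (positive_variation M \<rho>) E \<le> emeasure (total_variation M \<nu>) E"
    if "E \<notin> sets M" for E
    using that by (simp add: emeasure_notin_sets)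
  moreover have "space (positive_variation M \<rho>) = space (total_variation M \<nu>)"
    by (rule sets_eq_imp_space_eq) simp
  ultimately show ?thesis
    by (auto simp: le_measure_iff le_fun_def)
qed

lemma integrable_mono_measure:
  fixes f :: "'w \<Rightarrow> 'b::{banach, second_countable_topology}"
  assumes "N \<le> N'" "sets N = sets N'" "integrable N' f"
  shows "integrable N f"
proof -
  have "nn_integral N (\<lambda>x. norm (f x)) \<le> nn_integral N' (\<lambda>x. norm (f x))"
    by (rule nn_integral_mono_measure[OF assms(2,1)])
  moreover have "f \<in> borel_measurable N"
    using borel_measurable_integrable[OF assms(3)] measurable_cong_sets[OF assms(2) refl] by blast
  ultimately show ?thesis
    using assms(3) unfolding integrable_iff_bounded by (auto intro: le_less_trans)
qed


subsection \<open>Integrals as limits of sums of values of the measure\<close>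

text \<open>The integral of a simple function, in a form that makes sense for any complex set
  function and is visibly linear in \<open>\<nu>\<close>.\<close>

definition simple_sum :: "'w measure \<Rightarrow> ('w \<Rightarrow> complex) \<Rightarrow> ('w set \<Rightarrow> complex) \<Rightarrow> complex"
  where "simple_sum M s \<nu> = (\<Sum>y\<in>s ` space M. \<nu> {x \<in> space M. s x = y} * y)"

text \<open>For a finite measure the simple sum is the integral of \<open>s i\<close>, and
  \<open>2 * cmod (f x)\<close> is an integrable majorant.\<close>

lemma simple_sum_measure_tendsto:
  assumes N: "finite_measure N" "sets N = sets M"
    and f: "integrable N f"
    and s: "\<And>i. simple_function M (s i)"
      "\<And>x. x \<in> space M \<Longrightarrow> (\<lambda>i. s i x) \<longlonglongrightarrow> f x"
      "\<And>i x. x \<in> space M \<Longrightarrow> cmod (s i x) \<le> 2 * cmod (f x)"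
  shows "(\<lambda>i. simple_sum M (s i) (\<lambda>E. of_real (measure N E))) \<longlonglongrightarrow> integral\<^sup>L N f"
proof -
  interpret finite_measure N by fact
  have sp: "space N = space M" using N(2) by (rule sets_eq_imp_space_eq)
  have sf: "simple_function N (s i)" for i
    using s(1)[of i] by (simp add: simple_function_def sp N(2))
  have "integral\<^sup>L N (s i) = simple_sum M (s i) (\<lambda>E. of_real (measure N E))" for i
    using simple_bochner_integrable_eq_integral[OF simple_bochner_integrable.intros[OF sf[of i]]]
    by (simp add: simple_bochner_integral_def simple_sum_def sp scaleR_conv_of_real emeasure_eq_measure)
  moreover have "(\<lambda>i. integral\<^sup>L N (s i)) \<longlonglongrightarrow> integral\<^sup>L N f"
  proof (rule integral_dominated_convergence)
    show "integrable N (\<lambda>x. 2 * cmod (f x))" using f by simp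
    show "f \<in> borel_measurable N" using f by simp
    show "s i \<in> borel_measurable N" for i using sf by (rule borel_measurable_simple_function)
  qed (auto simp: s sp intro!: AE_I2)
  ultimately show ?thesis by simp
qed

text \<open>The Jordan decomposition reduces this to two finite measures.\<close>

lemma simple_sum_signed_tendsto:
  assumes \<rho>: "signed_measure M \<rho>"
    and f: "integrable (positive_variation M \<rho>) f" "integrable (positive_variation M (\<lambda>E. - \<rho> E)) f"
    and s: "\<And>i. simple_function M (s i)"
      "\<And>x. x \<in> space M \<Longrightarrow> (\<lambda>i. s i x) \<longlonglongrightarrow> f x"
      "\<And>i x. x \<in> space M \<Longrightarrow> cmod (s i x) \<le> 2 * cmod (f x)"
  shows "(\<lambda>i. simple_sum M (s i) (\<lambda>E. of_real (\<rho> E))) \<longlonglongrightarrow> signed_integral M \<rho> f"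
proof -
  interpret signed_measure M \<rho> by fact
  interpret neg: signed_measure M "\<lambda>E. - \<rho> E" by (rule signed_measure_uminus)
  have level: "{x \<in> space M. s i x = y} \<in> sets M" for i y
    using simple_functionD(2)[OF s(1), of i "{y}"]
    by (simp add: vimage_def Int_def conj_commute)
  have diff: "of_real (\<rho> E) * y = of_real (measure (positive_variation M \<rho>) E) * y -
      of_real (measure (positive_variation M (\<lambda>E. - \<rho> E)) E) * y"
    if "E \<in> sets M" for E and y :: complex
    by (subst measure_positive_variation_diff[OF that, symmetric])
      (simp only: of_real_diff left_diff_distrib)
  have "simple_sum M (s i) (\<lambda>E. of_real (\<rho> E)) =
      simple_sum M (s i) (\<lambda>E. of_real (measure (positive_variation M \<rho>) E)) -
      simple_sum M (s i) (\<lambda>E. of_real (measure (positive_variation M (\<lambda>E. - \<rho> E)) E))" for i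
    unfolding simple_sum_def sum_subtractf[symmetric] by (intro sum.cong refl diff level)
  then show ?thesis
    unfolding signed_integral_def
    using tendsto_diff[OF
        simple_sum_measure_tendsto[OF finite_measure_positive_variation sets_positive_variation f(1) s]
        simple_sum_measure_tendsto[OF neg.finite_measure_positive_variation neg.sets_positive_variation
          f(2) s]] by simp
qed

section \<open>The four Jordan variations of a complex measure\<close>

definition variations_of :: "'w measure \<Rightarrow> ('w set \<Rightarrow> complex) \<Rightarrow> 'w measure set"
  where "variations_of M \<nu> = positive_variation M `
    {\<lambda>E. Re (\<nu> E), \<lambda>E. - Re (\<nu> E), \<lambda>E. Im (\<nu> E), \<lambda>E. - Im (\<nu> E)}"

context
  fixes M :: "'w measure" and \<nu> :: "'w set \<Rightarrow> complex"
  assumes \<nu>: "complex_measure M \<nu>"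
begin

lemma signed_measure_Re: "signed_measure M (\<lambda>E. Re (\<nu> E))"
  and signed_measure_Im: "signed_measure M (\<lambda>E. Im (\<nu> E))"
  using \<nu> by (auto simp: signed_measure_def complex_measure_iff bounded_linear_Re bounded_linear_Im
      intro: sigma_additive.bounded_linear_image)

lemma variations_of:
  assumes "N \<in> variations_of M \<nu>"
  shows "finite_measure N" "sets N = sets M" "N \<le> total_variation M \<nu>"
proof -
  obtain \<rho> where N: "N = positive_variation M \<rho>" and \<rho>: "signed_measure M \<rho>"
    and le: "\<And>E. \<bar>\<rho> E\<bar> \<le> cmod (\<nu> E)"
    using assms signed_measure_Re signed_measure_Im
      signed_measure.signed_measure_uminus[OF signed_measure_Re]
      signed_measure.signed_measure_uminus[OF signed_measure_Im]
    by (auto simp: variations_of_def abs_Re_le_cmod abs_Im_le_cmod)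
  interpret signed_measure M \<rho> by fact
  show "finite_measure N" "sets N = sets M" "N \<le> total_variation M \<nu>"
    by (simp_all add: N finite_measure_positive_variation positive_variation_le_total_variation \<nu> le)
qed

lemma integrable_variations_of:
  fixes f :: "'w \<Rightarrow> complex"
  assumes "integrable (total_variation M \<nu>) f" "N \<in> variations_of M \<nu>"
  shows "integrable N f"
  using integrable_mono_measure[OF variations_of(3) _ assms(1)] variations_of(2) assms(2) by simp

text \<open>Jordan variations do not depend linearly on the measure; the limit of simple sums
  recovers the linear dependence of the integral on \<open>\<nu>\<close>.\<close>

lemma simple_sum_tendsto_complex_integral:
  assumes f: "integrable (total_variation M \<nu>) f"
    and s: "\<And>i. simple_function M (s i)"
      "\<And>x. x \<in> space M \<Longrightarrow> (\<lambda>i. s i x) \<longlonglongrightarrow> f x"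
      "\<And>i x. x \<in> space M \<Longrightarrow> cmod (s i x) \<le> 2 * cmod (f x)"
  shows "(\<lambda>i. simple_sum M (s i) \<nu>) \<longlonglongrightarrow> complex_integral M \<nu> f"
proof -
  have int: "integrable N f" if "N \<in> variations_of M \<nu>" for N
    by (rule integrable_variations_of[OF f that])
  have "simple_sum M (s i) \<nu> = simple_sum M (s i) (\<lambda>E. of_real (Re (\<nu> E))) +
      \<i> * simple_sum M (s i) (\<lambda>E. of_real (Im (\<nu> E)))" for i
  proof -
    have "\<nu> E * y = of_real (Re (\<nu> E)) * y + \<i> * (of_real (Im (\<nu> E)) * y)" for E y
      by (metis complex_eq distrib_right mult.assoc)
    then show ?thesis
      by (simp add: simple_sum_def sum_distrib_left flip: sum.distrib)
  qed
  moreover have "(\<lambda>i. simple_sum M (s i) (\<lambda>E. of_real (Re (\<nu> E)))) \<longlonglongrightarrow> signed_integral M (\<lambda>E. Re (\<nu> E)) f"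
    by (rule simple_sum_signed_tendsto[OF signed_measure_Re int int s]) (simp_all add: variations_of_def)
  moreover have "(\<lambda>i. simple_sum M (s i) (\<lambda>E. of_real (Im (\<nu> E)))) \<longlonglongrightarrow> signed_integral M (\<lambda>E. Im (\<nu> E)) f"
    by (rule simple_sum_signed_tendsto[OF signed_measure_Im int int s]) (simp_all add: variations_of_def)
  ultimately show ?thesis
    unfolding complex_integral_def by (simp add: tendsto_add tendsto_mult_left)
qed

lemma complex_integral_dominated_convergence:
  fixes f :: "'w \<Rightarrow> complex" and f_seq :: "nat \<Rightarrow> 'w \<Rightarrow> complex" and g :: "'w \<Rightarrow> real"
  assumes meas: "f \<in> borel_measurable M" "\<And>n. f_seq n \<in> borel_measurable M"
    and lim: "\<And>x. x \<in> space M \<Longrightarrow> (\<lambda>n. f_seq n x) \<longlonglongrightarrow> f x"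
    and g: "integrable (total_variation M \<nu>) g"
    and dom: "\<And>n x. x \<in> space M \<Longrightarrow> cmod (f_seq n x) \<le> g x"
  shows "integrable (total_variation M \<nu>) f"
    and "(\<lambda>n. complex_integral M \<nu> (f_seq n)) \<longlonglongrightarrow> complex_integral M \<nu> f"
proof -
  \<comment> \<open>Used with the total variation for the integrability of \<open>f\<close>, and
    with the four Jordan variations for the convergence.\<close>
  have dct: "integrable N f" "(\<lambda>n. integral\<^sup>L N (f_seq n)) \<longlonglongrightarrow> integral\<^sup>L N f"
    if sets: "sets N = sets M" and "integrable N g" for N
  proof -
    have sp: "space N = space M" using sets by (rule sets_eq_imp_space_eq)
    have m: "f \<in> borel_measurable N" "\<And>n. f_seq n \<in> borel_measurable N"
      using meas measurable_cong_sets[OF sets refl] by auto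
    have ae: "AE x in N. (\<lambda>n. f_seq n x) \<longlonglongrightarrow> f x" "\<And>n. AE x in N. cmod (f_seq n x) \<le> g x"
      using lim dom by (auto simp: sp intro!: AE_I2)
    show "integrable N f" "(\<lambda>n. integral\<^sup>L N (f_seq n)) \<longlonglongrightarrow> integral\<^sup>L N f"
      using integrable_dominated_convergence[OF m(1,2) that(2) ae]
        integral_dominated_convergence[OF m(1,2) that(2) ae] by auto
  qed
  show "integrable (total_variation M \<nu>) f" by (rule dct(1)) (simp_all add: g)
  have *: "(\<lambda>n. integral\<^sup>L N (f_seq n)) \<longlonglongrightarrow> integral\<^sup>L N f" if "N \<in> variations_of M \<nu>" for N
    using variations_of[OF that] g
    by (intro dct(2) integrable_mono_measure[of N "total_variation M \<nu>"]) auto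
  show "(\<lambda>n. complex_integral M \<nu> (f_seq n)) \<longlonglongrightarrow> complex_integral M \<nu> f"
    unfolding complex_integral_def signed_integral_def
    \<comment> \<open>Read as an inclusion, \<open>variations_of_def\<close> makes each of the four
      measures a member, so that \<open>*\<close> applies.\<close>
    by (intro tendsto_add tendsto_mult_left tendsto_diff * imageI insertI1 insertI2
        variations_of_def[THEN equalityD2, THEN subsetD])
qed

end

subsection \<open>Completeness of the dual and the uniform boundedness principle\<close>

text \<open>\<open>\<iota>\<close> is an isometry into the complete space of bounded real-linear
  maps, and complex homogeneity survives pointwise limits.\<close>

instance cdual :: (complex_normed_vector) banach
proof
  fix X :: "nat \<Rightarrow> 'a cdual"
  assume "Cauchy X"
  define \<iota> where "\<iota> F = Blinfun (cdual_apply F)" for F :: "'a cdual"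
  have app: "blinfun_apply (\<iota> F) = cdual_apply F" for F
    by (simp add: \<iota>_def bounded_linear_Blinfun_apply bounded_linear_cdual_apply)
  have dist: "dist (\<iota> F) (\<iota> G) = dist F G" for F G
    by (simp add: dist_norm norm_blinfun.rep_eq norm_cdual.rep_eq minus_blinfun.rep_eq
        minus_cdual.rep_eq app)
  have "Cauchy (\<lambda>n. \<iota> (X n))"
    using \<open>Cauchy X\<close> by (simp add: Cauchy_def dist)
  then obtain L where L: "(\<lambda>n. \<iota> (X n)) \<longlonglongrightarrow> L"
    using Cauchy_convergent_iff convergent_def by blast
  have lim: "(\<lambda>n. cdual_apply (X n) x) \<longlonglongrightarrow> blinfun_apply L x" for x
    using blinfun.tendsto[OF L tendsto_const[of x]] by (simp add: app)
  have "blinfun_apply L (c *\<^sub>C x) = c *\<^sub>C blinfun_apply L x" for c x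
  proof (rule LIMSEQ_unique[OF lim])
    have "cdual_apply (X n) (c *\<^sub>C x) = c * cdual_apply (X n) x" for n
      using bounded_clinear_cdual_apply[of "X n"] by (simp add: bounded_clinear_def scaleC_complex_def)
    then show "(\<lambda>n. cdual_apply (X n) (c *\<^sub>C x)) \<longlonglongrightarrow> c *\<^sub>C blinfun_apply L x"
      by (simp add: scaleC_complex_def tendsto_mult_left lim)
  qed
  then have "bounded_clinear (blinfun_apply L)"
    by (simp add: bounded_clinear_def blinfun.bounded_linear_right)
  then have \<iota>_lim: "\<iota> (Cdual (blinfun_apply L)) = L"
    by (simp add: \<iota>_def Cdual_inverse blinfun_apply_inverse)
  have "(\<lambda>n. dist (\<iota> (X n)) (\<iota> (Cdual (blinfun_apply L)))) \<longlonglongrightarrow> 0"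
    using L[THEN tendsto_dist_iff[THEN iffD1]] unfolding \<iota>_lim .
  then have "X \<longlonglongrightarrow> Cdual (blinfun_apply L)"
    unfolding dist by (subst tendsto_dist_iff)
  then show "convergent X" by (rule convergentI)
qed

text \<open>The uniform boundedness principle: pointwise convergence bounds each sequence
  \<open>T n x\<close>, and completeness makes the bound uniform on a ball.\<close>

lemma bounded_linear_pointwise_limit:
  fixes T :: "nat \<Rightarrow> 'a::banach \<Rightarrow> 'b::real_normed_vector"
  assumes T: "\<And>n. linear (T n)" "\<And>n. continuous_on UNIV (T n)"
    and lim: "\<And>x. (\<lambda>n. T n x) \<longlonglongrightarrow> L x"
  shows "bounded_linear L"
proof -
  have add: "L (x + y) = L x + L y" for x y
  proof (rule LIMSEQ_unique[OF lim])
    show "(\<lambda>n. T n (x + y)) \<longlonglongrightarrow> L x + L y"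
      by (simp add: linear_add[OF T(1)] tendsto_add lim)
  qed
  have scale: "L (r *\<^sub>R x) = r *\<^sub>R L x" for r x
  proof (rule LIMSEQ_unique[OF lim])
    show "(\<lambda>n. T n (r *\<^sub>R x)) \<longlonglongrightarrow> r *\<^sub>R L x"
      by (simp add: linear_scale[OF T(1)] tendsto_scaleR lim)
  qed
  \<comment> \<open>By Baire's theorem one of the closed sets on which all \<open>T n\<close> are bounded by \<open>k\<close> contains a ball.\<close>
  define A where "A k = {x. \<forall>n. norm (T n x) \<le> real k}" for k
  have closed: "closed (A k)" for k
  proof -
    have "closed {x. norm (T n x) \<le> real k}" for n
      by (intro closed_Collect_le continuous_on_norm T(2) continuous_on_const)
    then show ?thesis unfolding A_def by (rule closed_Collect_all)
  qed
  have cover: "(\<Union>k. A k) = UNIV"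
  proof (intro set_eqI iffI UNIV_I)
    fix x
    have "bounded (range (\<lambda>n. T n x))"
      using lim[of x] by (intro convergent_imp_bounded) (auto simp: convergent_def)
    then obtain B where "\<And>n. norm (T n x) \<le> B" by (auto simp: bounded_iff)
    moreover obtain k where "B \<le> real k" using real_arch_simple by blast
    ultimately have "x \<in> A k" unfolding A_def by (auto intro: order_trans)
    then show "x \<in> (\<Union>k. A k)" by blast
  qed
  have "\<exists>k. interior (A k) \<noteq> {}"
  proof (rule ccontr)
    assume "\<not> ?thesis"
    then have "Met_TC.mtopology interior_of (\<Union>(range A)) = {}"
      by (intro Met_TC.metric_Baire_category_alt) (auto simp: complete_UNIV closed)
    then show False by (simp add: cover)
  qed
  then obtain k x r where r: "r > 0" "cball x r \<subseteq> A k"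
    by (metis all_not_in_conv mem_interior_cball)
  \<comment> \<open>Moving the ball to the origin costs a factor of two; the bound is uniform in
    \<open>n\<close> and passes to the limit.\<close>
  have bound: "norm (L y) \<le> 2 * real k" if y: "norm y \<le> r" for y
  proof -
    have "norm (T n y) \<le> 2 * real k" for n
    proof -
      have "x + y \<in> A k" "x \<in> A k" using y r by (auto simp: subset_eq dist_norm)
      then have "norm (T n (x + y)) \<le> real k" "norm (T n x) \<le> real k" by (auto simp: A_def)
      moreover have "T n y = T n (x + y) - T n x" by (simp add: linear_add[OF T(1)])
      ultimately show ?thesis using norm_triangle_ineq4[of "T n (x + y)" "T n x"] by simp
    qed
    then show ?thesis
      by (intro LIMSEQ_le_const2[OF tendsto_norm[OF lim]]) blast
  qed
  have "norm (L y) \<le> norm y * (2 * real k / r)" for y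
  proof (cases "y = 0")
    case True
    then show ?thesis using scale[of 0 0] by simp
  next
    case False
    have "norm (L ((r / norm y) *\<^sub>R y)) \<le> 2 * real k"
      using False r(1) by (intro bound) simp
    then show ?thesis using False r(1) by (simp add: scale field_simps)
  qed
  with add scale show ?thesis by (rule bounded_linear_intro)
qed

section \<open>The vector integral as an element of the bidual\<close>

context
  fixes M :: "'w measure" and \<mu> :: "'x::complex_normed_vector cdual \<Rightarrow> 'w set \<Rightarrow> complex"
  assumes \<mu>: "vector_projection_family M \<mu>"
begin

lemma vector_projection_family_simple_sum:
  assumes s: "simple_function M s"
  defines "T \<equiv> \<lambda>\<Lambda>. simple_sum M s (\<mu> \<Lambda>)"
  shows "T (\<Lambda> + \<Lambda>') = T \<Lambda> + T \<Lambda>'" "T (c *\<^sub>C \<Lambda>) = c * T \<Lambda>" "continuous_on UNIV T"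
proof -
  have level: "{x \<in> space M. s x = y} \<in> sets M" for y
    using simple_functionD(2)[OF s, of "{y}"] by (simp add: vimage_def Int_def conj_commute)
  show "T (\<Lambda> + \<Lambda>') = T \<Lambda> + T \<Lambda>'" "T (c *\<^sub>C \<Lambda>) = c * T \<Lambda>"
    using \<mu> level
    by (simp_all add: T_def simple_sum_def vector_projection_family_def sum.distrib distrib_right
        sum_distrib_left mult.assoc)
  \<comment> \<open>This is the setwise continuity of the family along the filter
    \<open>at \<Lambda>\<close>.\<close>
  have "isCont (\<lambda>\<Lambda>. \<mu> \<Lambda> E) \<Lambda>" if "E \<in> sets M" for E \<Lambda>
    using \<mu> that tendsto_ident_at[of \<Lambda> UNIV]
    unfolding vector_projection_family_def setwise_tendsto_def isCont_def by blast
  then show "continuous_on UNIV T"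
    unfolding T_def simple_sum_def
    by (intro continuous_on_sum continuous_on_mult continuous_on_const continuous_at_imp_continuous_on)
      (auto simp: level)
qed

text \<open>Membership in the bidual is part of convergence in \<open>weak_star_topology\<close>, so
  it is required of the limit as well as of the sequence.\<close>

lemma bounded_clinear_vector_integral:
  assumes h: "h \<in> vector_L1 M \<mu>"
  shows "bounded_clinear (vector_integral M \<mu> h)"
proof -
  have "h \<in> borel_measurable M" and int: "\<And>\<Lambda>. integrable (total_variation M (\<mu> \<Lambda>)) h"
    using h by (auto simp: vector_L1_def)
  \<comment> \<open>Base point \<open>0\<close> in the metric approximation turns its distance bound
    into one on \<open>cmod\<close>.\<close>
  obtain s where s: "\<And>i. simple_function M (s i)" "\<And>x. x \<in> space M \<Longrightarrow> (\<lambda>i. s i x) \<longlonglongrightarrow> h x"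
      "\<And>i x. x \<in> space M \<Longrightarrow> cmod (s i x) \<le> 2 * cmod (h x)"
    using borel_measurable_implies_sequence_metric[OF \<open>h \<in> borel_measurable M\<close>, of 0] by fastforce
  define T where "T i \<Lambda> = simple_sum M (s i) (\<mu> \<Lambda>)" for i \<Lambda>
  note T = vector_projection_family_simple_sum[OF s(1), folded T_def]
  have lim: "(\<lambda>i. T i \<Lambda>) \<longlonglongrightarrow> vector_integral M \<mu> h \<Lambda>" for \<Lambda>
    unfolding T_def vector_integral_def using \<mu>
    by (intro simple_sum_tendsto_complex_integral int s) (auto simp: vector_projection_family_def)
  \<comment> \<open>Real homogeneity is the complex one at \<open>complex_of_real r\<close>.\<close>
  have "linear (T i)" for i
    by (rule linearI) (simp_all add: T scaleC_complex_def flip: scaleC_of_real)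
  then have "bounded_linear (vector_integral M \<mu> h)"
    using T(3) lim by (rule bounded_linear_pointwise_limit)
  moreover have "vector_integral M \<mu> h (c *\<^sub>C \<Lambda>) = c *\<^sub>C vector_integral M \<mu> h \<Lambda>" for c \<Lambda>
  proof (rule LIMSEQ_unique[OF lim])
    show "(\<lambda>i. T i (c *\<^sub>C \<Lambda>)) \<longlonglongrightarrow> c *\<^sub>C vector_integral M \<mu> h \<Lambda>"
      by (simp add: T scaleC_complex_def tendsto_mult_left lim)
  qed
  ultimately show ?thesis by (simp add: bounded_clinear_def)
qed

end

subsection \<open>Dominated convergence\<close>

text \<open>The product topology contributes pointwise convergence, the subtopology the two
  membership conditions.\<close>

lemma limitin_weak_star_topology:
  "limitin weak_star_topology \<Phi> \<Psi> F \<longleftrightarrow>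
    bounded_clinear \<Psi> \<and> (\<forall>\<^sub>F i in F. bounded_clinear (\<Phi> i)) \<and> (\<forall>x. ((\<lambda>i. \<Phi> i x) \<longlongrightarrow> \<Psi> x) F)"
  by (simp add: weak_star_topology_def limitin_subtopology limitin_componentwise)

theorem mainTheorem3:
  fixes M :: "'w measure"
    and \<mu> :: "'x::complex_banach cdual \<Rightarrow> 'w set \<Rightarrow> complex"
    and f :: "'w \<Rightarrow> complex"
    and f_seq :: "nat \<Rightarrow> 'w \<Rightarrow> complex"
    and g :: "'w \<Rightarrow> real"
  assumes "vector_projection_family M \<mu>"
    and "\<And>n. f_seq n \<in> vector_L1 M \<mu>"
    and "\<And>\<omega>. \<omega> \<in> space M \<Longrightarrow> (\<lambda>n. f_seq n \<omega>) \<longlonglongrightarrow> f \<omega>"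
    and "(\<lambda>\<omega>. complex_of_real (g \<omega>)) \<in> vector_L1 M \<mu>"
    and "\<And>n \<omega>. \<omega> \<in> space M \<Longrightarrow> cmod (f_seq n \<omega>) \<le> g \<omega>"
  shows "f \<in> vector_L1 M \<mu> \<and>
    limitin weak_star_topology (\<lambda>n. vector_integral M \<mu> (f_seq n)) (vector_integral M \<mu> f) sequentially"
proof -
  have \<mu>: "complex_measure M (\<mu> \<Lambda>)" for \<Lambda>
    using assms(1) by (simp add: vector_projection_family_def)
  have fm: "f_seq n \<in> borel_measurable M" for n
    using assms(2) by (simp add: vector_L1_def)
  have f: "f \<in> borel_measurable M"
    using fm assms(3) by (rule borel_measurable_LIMSEQ_metric)
  \<comment> \<open>\<open>g\<close> belongs to \<open>vector_L1\<close> as a complex function but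
    serves as a real majorant.\<close>
  have g: "integrable (total_variation M (\<mu> \<Lambda>)) g" for \<Lambda>
    using assms(4) by (simp add: vector_L1_def complex_of_real_integrable_eq)
  note dct = complex_integral_dominated_convergence[OF \<mu> f fm assms(3) g assms(5)]
  have fL1: "f \<in> vector_L1 M \<mu>"
    using f dct(1) by (simp add: vector_L1_def)
  have "(\<lambda>n. vector_integral M \<mu> (f_seq n) \<Lambda>) \<longlonglongrightarrow> vector_integral M \<mu> f \<Lambda>" for \<Lambda>
    unfolding vector_integral_def by (rule dct(2))
  then show ?thesis
    using fL1 bounded_clinear_vector_integral[OF assms(1)] assms(2)
    by (simp add: limitin_weak_star_topology)
qed

end
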